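(* Let $\mathcal{P}$ be a poset on $[p]$ and let $\rho:[p]\to\mathbb{Z}$ be a map. Then $$\mathscr{A}_\rho(\mathcal{P})=\bigsqcup_{\mathcal{L}\in\mathscr{L}(\mathcal{P})}\mathscr{A}_\rho(\mathcal{L}),$$ a disjoint union over the set $\mathscr{L}(\mathcal{P})$ of linear extensions of $\mathcal{P}$.
   Context: A poset $\mathcal{P}$ on $[p]=\{1,\dots,p\}$ is a partial order $\prec$ on the set $[p]$; $<$ denotes the natural order on integers. $\mathbb{N}=\{1,2,3,\dots\}$. A linear extension of $\mathcal{P}$ is a linear (total) order on $[p]$ that extends the partial order of $\mathcal{P}$; it is itself a poset on $[p]$. Given $\rho:[p]\to\mathbb{Z}$, a $(\mathcal{P},\rho)$-partition is a function $f:[p]\to\mathbb{N}$ such that (1) if $i\prec j$ then $f(i)\le f(j)$; (2) if $i\prec j$ and $i>j$ then $f(i)<f(j)$; (3) $f(i)\le\rho(i)$ for all $i$. $\mathscr{A}_\rho(\mathcal{P})$ denotes the set of all $(\mathcal{P},\rho)$-partitions. *)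

theory Defs
  imports Main "HOL-Library.FuncSet" "HOL-Library.Disjoint_Sets"
begin

text \<open>
  A poset on \<open>[p]\<close> is a relation \<open>P :: nat rel\<close> with \<open>partial_order_on {1..p} P\<close>. Such a relation
  is reflexive, so the strict order \<open>i \<prec> j\<close> is \<open>(i, j) \<in> P \<and> i \<noteq> j\<close>. The natural order on the
  labels is the order of \<^typ>\<open>nat\<close>.
\<close>

definition linear_extensions :: "nat \<Rightarrow> nat rel \<Rightarrow> nat rel set" where
  "linear_extensions p P = {L. linear_order_on {1..p} L \<and> P \<subseteq> L}"

definition strictly_below :: "nat rel \<Rightarrow> nat \<Rightarrow> nat \<Rightarrow> bool" where
  "strictly_below P i j \<longleftrightarrow> (i, j) \<in> P \<and> i \<noteq> j"

text \<open>
  Maps \<open>[p] \<rightarrow> {1, 2, 3, \<dots>}\<close> are the extensional functions on \<open>{1..p}\<close>, so that each map has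
  exactly one representative. Only the values of \<open>\<rho>\<close> on \<open>{1..p}\<close> matter; they may be zero or
  negative.
\<close>

definition rho_partitions :: "nat \<Rightarrow> (nat \<Rightarrow> int) \<Rightarrow> nat rel \<Rightarrow> (nat \<Rightarrow> nat) set" where
  "rho_partitions p \<rho> P =
    {f \<in> {1..p} \<rightarrow>\<^sub>E {1..}.
       (\<forall>i\<in>{1..p}. \<forall>j\<in>{1..p}. strictly_below P i j \<longrightarrow> f i \<le> f j) \<and>
       (\<forall>i\<in>{1..p}. \<forall>j\<in>{1..p}. strictly_below P i j \<and> i > j \<longrightarrow> f i < f j) \<and>
       (\<forall>i\<in>{1..p}. int (f i) \<le> \<rho> i)}"

end

theory Submission
  imports Defs
begin

text \<open>
  The idea is that a map \<open>f\<close> on \<open>[p]\<close> sorts the labels in exactly one way: by increasing value,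
  ties being broken by the natural order of the labels. Call the resulting linear order
  \<open>sorting_order p f\<close>. The two monotonicity conditions on a partition say together that \<open>i \<prec> j\<close>
  forces \<open>i\<close> to precede \<open>j\<close> in this sorting: either the value strictly increases, or it stays
  the same and then \<open>i < j\<close>. So, for positive \<open>f\<close> bounded by
  \<open>\<rho>\<close>, being a partition for \<open>P\<close> just means \<open>P \<subseteq> sorting_order p f\<close>
  (lemma \<open>rho_partitions_iff_subset_sorting_order\<close>).

  If \<open>f\<close> is a partition for \<open>P\<close>, then \<open>sorting_order p f\<close> is therefore a linear extension of
  \<open>P\<close>, and \<open>f\<close> is trivially a partition for it. Conversely, a partition for an extension of \<open>P\<close>
  is one for \<open>P\<close>. Finally, if \<open>f\<close> is a partition for a linear order \<open>L\<close>, then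
  \<open>L \<subseteq> sorting_order p f\<close>; as linear orders on one set are equal when one contains the other,
  \<open>L\<close> is determined by \<open>f\<close>, and the union is disjoint.
\<close>

definition sorting_order :: "nat \<Rightarrow> (nat \<Rightarrow> nat) \<Rightarrow> nat rel" where
  "sorting_order p f =
    {(i, j) \<in> {1..p} \<times> {1..p}. f i < f j \<or> f i = f j \<and> i \<le> j}"

lemma linear_order_sorting_order: "linear_order_on {1..p} (sorting_order p f)"
  unfolding sorting_order_def order_on_defs refl_on_def trans_def antisym_def total_on_def
  by auto

text \<open>
  Both the weak condition and the strict one on descending labels become one inclusion of
  relations, so that the effect of enlarging \<open>P\<close> can be read off.
\<close>

lemma rho_partitions_iff_subset_sorting_order:
  assumes "P \<subseteq> {1..p} \<times> {1..p}"
  shows "f \<in> rho_partitions p \<rho> P \<longleftrightarrow>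
    f \<in> {1..p} \<rightarrow>\<^sub>E {1..} \<and> (\<forall>i\<in>{1..p}. int (f i) \<le> \<rho> i) \<and> P \<subseteq> sorting_order p f"
    (is "?L \<longleftrightarrow> ?R")
proof
  assume f: ?L
  have "(i, j) \<in> sorting_order p f" if ij: "(i, j) \<in> P" for i j
  proof -
    have mem: "i \<in> {1..p}" "j \<in> {1..p}"
      using ij assms by auto
    have "f i < f j \<or> f i = f j \<and> i \<le> j"
    proof (cases "i = j")
      case False
      then have "strictly_below P i j"
        using ij by (simp add: strictly_below_def)
      then have "f i \<le> f j" "j < i \<longrightarrow> f i < f j"
        using f mem unfolding rho_partitions_def by blast+
      then show ?thesis by linarith
    qed simp
    with mem show ?thesis by (simp add: sorting_order_def)
  qed
  with f show ?R by (auto simp: rho_partitions_def)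
next
  assume ?R
  then show ?L
    by (fastforce simp: rho_partitions_def strictly_below_def sorting_order_def)
qed

lemma linear_order_on_subset_eq:
  assumes "linear_order_on A L" "linear_order_on A M" "L \<subseteq> M"
  shows "L = M"
proof (rule antisym[OF \<open>L \<subseteq> M\<close>], rule subrelI)
  fix x y
  assume xy: "(x, y) \<in> M"
  then have "x \<in> A" "y \<in> A"
    using assms(2) by (auto simp: order_on_defs)
  then have "(x, y) \<in> L \<or> (y, x) \<in> L"
    using assms(1) unfolding order_on_defs refl_on_def total_on_def by metis
  then show "(x, y) \<in> L"
    using xy assms(2,3) by (auto simp: order_on_defs antisym_def)
qed

theorem theorem3p14:
  fixes p :: nat and P :: "nat rel" and \<rho> :: "nat \<Rightarrow> int"
  assumes "partial_order_on {1..p} P"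
  shows "rho_partitions p \<rho> P = (\<Union>L\<in>linear_extensions p P. rho_partitions p \<rho> L) \<and>
    disjoint_family_on (rho_partitions p \<rho>) (linear_extensions p P)"
proof -
  have P: "P \<subseteq> {1..p} \<times> {1..p}"
    using assms by (simp add: order_on_defs)
  have L: "L \<subseteq> {1..p} \<times> {1..p}" if "L \<in> linear_extensions p P" for L
    using that by (simp add: linear_extensions_def order_on_defs)
  have extension: "sorting_order p f \<in> linear_extensions p P"
    if "f \<in> rho_partitions p \<rho> P" for f
    using that linear_order_sorting_order
    by (simp add: linear_extensions_def rho_partitions_iff_subset_sorting_order[OF P])
  have sorted: "f \<in> rho_partitions p \<rho> (sorting_order p f)"
    if "f \<in> rho_partitions p \<rho> P" for f
    using that
    by (simp add: rho_partitions_iff_subset_sorting_order[OF P]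
        rho_partitions_iff_subset_sorting_order[OF L[OF extension[OF that]]])
  have coarser: "f \<in> rho_partitions p \<rho> P"
    if "L \<in> linear_extensions p P" "f \<in> rho_partitions p \<rho> L" for L f
    using that P L[OF that(1)]
    by (auto simp: linear_extensions_def rho_partitions_iff_subset_sorting_order)
  have unique: "L = sorting_order p f"
    if "L \<in> linear_extensions p P" "f \<in> rho_partitions p \<rho> L" for L f
    using that L[OF that(1)] linear_order_on_subset_eq[OF _ linear_order_sorting_order]
    by (simp add: linear_extensions_def rho_partitions_iff_subset_sorting_order)
  show ?thesis
  proof
    show "rho_partitions p \<rho> P = (\<Union>L\<in>linear_extensions p P. rho_partitions p \<rho> L)"
      using extension sorted coarser by blast
    show "disjoint_family_on (rho_partitions p \<rho>) (linear_extensions p P)"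
    unfolding disjoint_family_on_def
    proof (intro ballI impI)
      fix L M
      assume "L \<in> linear_extensions p P" "M \<in> linear_extensions p P" "L \<noteq> M"
      then show "rho_partitions p \<rho> L \<inter> rho_partitions p \<rho> M = {}"
        using unique[of L] unique[of M] by fastforce
    qed
  qed
qed

end
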